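(* Let $k\ge1$, $1\le l\le m$, and let $F:\mathbb{R}^m\to\mathbb{R}$ and $c_i:\mathbb{R}^m\to\mathbb{R}$ ($i=1,\dots,l$) be $C^k$ functions with $F(0)=0$ and $c_i(0)=0$. Assume that there is a neighborhood $N$ of $x=0$ such that $F(x)=0$ for all $x\in N$ with $c_1(x)=c_2(x)=\cdots=c_l(x)=0$. If the Jacobian matrix of $(c_1,\dots,c_l)$ at $x=0$ has full rank, then there exist a neighborhood $N^*\subset N$ of $x=0$ and $C^{k-1}$ functions $F_1,\dots,F_l$ such that $$F(x)=\sum_{i=1}^l c_i(x)F_i(x)\qquad\text{for } x\in N^*.$$ In addition, if $\nabla F(0)=0$, then $F_1(0)=F_2(0)=\cdots=F_l(0)=0$.
   Context: $\nabla F$ denotes the gradient. $C^0$ means continuous. *)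

theory Defs
  imports "HOL-Analysis.Analysis"
begin

(* Class C^k on the whole space, by recursion on k: f is C^(k+1) iff it is differentiable
   everywhere and, for each fixed direction v, the derivative x |-> Df(x) v is C^k.  In finite
   dimension this says that all partial derivatives of order at most k exist and are continuous.
   Differentiability is required explicitly because frechet_derivative is a choice operator. *)
fun Ck :: "nat \<Rightarrow> ('a::euclidean_space \<Rightarrow> 'b::real_normed_vector) \<Rightarrow> bool" where
  "Ck 0 f \<longleftrightarrow> continuous_on UNIV f"
| "Ck (Suc k) f \<longleftrightarrow>
     (\<forall>x. f differentiable (at x)) \<and> (\<forall>v. Ck k (\<lambda>x. frechet_derivative f (at x) v))"

end

theory Submission
  imports Defs
begin

text \<open>
  The idea is to choose \<open>C\<^sup>k\<close> coordinates in which the functions \<open>c\<^sub>i\<close> are linear, and then to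
  integrate the derivative of \<open>F\<close> along straight lines that end on the common zero set.

  Let \<open>C = (c\<^sub>1, \<dots>, c\<^sub>l)\<close>, let \<open>J\<close> be its derivative at \<open>0\<close>, and let \<open>B\<close> be a linear right inverse
  of \<open>J\<close>, which exists by the rank hypothesis. The map \<open>x \<mapsto> x + B (C x - J x)\<close> is tangent to the
  identity at \<open>0\<close> and \<open>J\<close> carries it to \<open>C\<close>, because \<open>J B\<close> is the identity. Composing the
  perturbation \<open>B (C x - J x)\<close> with a bounded \<open>C\<^sup>k\<close> map that is the identity near \<open>0\<close> makes its
  derivative small on the whole space without changing its germ (\<open>Ck_flatten\<close>). The resulting map
  \<open>\<phi>\<close> is then a global \<open>C\<^sup>k\<close> diffeomorphism with inverse \<open>\<psi>\<close>
  (\<open>Ck_perturbed_identity_inverse\<close>), and \<open>J (\<phi> x) = C x\<close> near \<open>0\<close>.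

  Put \<open>G = F \<circ> \<psi>\<close>. The map \<open>B J\<close> is a projection, and integrating the derivative of \<open>G\<close> along the
  segment from \<open>z - B (J z)\<close> to \<open>z\<close> gives
  \<open>G z = G (z - B (J z)) + \<Sum>\<^sub>i (J z)\<^sub>i K\<^sub>i z\<close> with \<open>C\<^bsup>k-1\<^esup>\<close> functions \<open>K\<^sub>i\<close> (\<open>Ck_hadamard\<close>). For
  \<open>z = \<phi> x\<close> with \<open>x\<close> near \<open>0\<close> the coefficients are \<open>c\<^sub>i x\<close>, and the first term is the value of \<open>F\<close>
  at a point near \<open>0\<close> where all \<open>c\<^sub>i\<close> vanish, hence \<open>0\<close>. So \<open>F\<^sub>i = K\<^sub>i \<circ> \<phi>\<close> is as required. At the
  origin the segment is a single point, so \<open>F\<^sub>i 0\<close> is a directional derivative of \<open>G\<close>, which vanishes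
  together with the gradient of \<open>F\<close>.

  Working with global maps throughout means that only functions of class \<open>C\<^sup>k\<close> on the whole space
  occur, and that the \<open>F\<^sub>i\<close> need no extension from a neighbourhood at the end.
\<close>

section \<open>Calculus of functions of class \<open>C\<^sup>k\<close>\<close>

text \<open>
  The derivative in the definition of \<open>Ck\<close> is a chosen one. The next two rules replace it by an
  arbitrary family of derivatives, so that inductions on \<open>k\<close> can use explicit formulas.
\<close>
lemma Ck_SucI:
  assumes "\<And>x. (f has_derivative f' x) (at x)" and "\<And>v. Ck k (\<lambda>x. f' x v)"
  shows "Ck (Suc k) f"
proof -
  have "frechet_derivative f (at x) = f' x" for x
    using frechet_derivative_at[OF assms(1)] by simp
  then show ?thesis
    using assms by (auto simp: differentiable_def)
qed

lemma Ck_SucE: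
  assumes "Ck (Suc k) f"
  obtains f' where "\<forall>x. (f has_derivative f' x) (at x)" "\<forall>v. Ck k (\<lambda>x. f' x v)"
  using assms frechet_derivative_works by (metis Ck.simps(2))

lemma Ck_Suc_imp: "Ck (Suc k) f \<Longrightarrow> Ck k f"
proof (induction k arbitrary: f)
  case 0
  then show ?case
    by (auto simp: continuous_on_eq_continuous_within differentiable_imp_continuous_within)
next
  case (Suc k)
  then show ?case by (metis Ck.simps(2))
qed

lemma Ck_mono: "Ck n f \<Longrightarrow> k \<le> n \<Longrightarrow> Ck k f"
  by (induction n) (auto simp: le_Suc_eq dest: Ck_Suc_imp simp del: Ck.simps)

lemma Ck_continuous: "Ck k f \<Longrightarrow> continuous_on S f"
  using Ck_mono[of k f 0] continuous_on_subset by auto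

lemma Ck_const: "Ck k (\<lambda>x. c)"
proof (induction k arbitrary: c)
  case (Suc k)
  show ?case by (rule Ck_SucI[where f' = "\<lambda>x v. 0"]) (auto intro: Suc)
qed auto

lemma Ck_id: "Ck k (\<lambda>x. x)"
proof (cases k)
  case (Suc n)
  show ?thesis unfolding Suc
    by (rule Ck_SucI[where f' = "\<lambda>x v. v"]) (auto intro: Ck_const)
qed auto

lemma Ck_bounded_linear:
  assumes L: "bounded_linear L"
  shows "Ck k f \<Longrightarrow> Ck k (\<lambda>x. L (f x))"
proof (induction k arbitrary: f)
  case 0
  then show ?case using L
    by (simp add: bounded_linear.continuous_on)
next
  case (Suc k)
  obtain f' where f'[rule_format]: "\<forall>x. (f has_derivative f' x) (at x)" "\<forall>v. Ck k (\<lambda>x. f' x v)"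
    using Suc.prems by (rule Ck_SucE)
  show ?case
    by (rule Ck_SucI[OF bounded_linear.has_derivative[OF L f'(1)] Suc.IH[OF f'(2)]])
qed

lemma Ck_add: "Ck k f \<Longrightarrow> Ck k g \<Longrightarrow> Ck k (\<lambda>x. f x + g x)"
proof (induction k arbitrary: f g)
  case 0
  then show ?case by (auto intro: continuous_intros)
next
  case (Suc k)
  obtain f' where f'[rule_format]: "\<forall>x. (f has_derivative f' x) (at x)" "\<forall>v. Ck k (\<lambda>x. f' x v)"
    using Suc.prems(1) by (rule Ck_SucE)
  obtain g' where g'[rule_format]: "\<forall>x. (g has_derivative g' x) (at x)" "\<forall>v. Ck k (\<lambda>x. g' x v)"
    using Suc.prems(2) by (rule Ck_SucE)
  show ?case
    by (rule Ck_SucI[OF has_derivative_add[OF f'(1) g'(1)] Suc.IH[OF f'(2) g'(2)]])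
qed

lemma Ck_sum: "(\<And>i. i \<in> I \<Longrightarrow> Ck k (f i)) \<Longrightarrow> Ck k (\<lambda>x. \<Sum>i\<in>I. f i x)"
  by (induction I rule: infinite_finite_induct) (auto intro: Ck_const Ck_add)

text \<open>
  By the Leibniz rule the derivative of a product is a sum of two products, each of a function with
  a derivative of the other; both factors have one order of smoothness less.
\<close>
lemma Ck_bilinear:
  assumes B: "bounded_bilinear pr"
  shows "Ck k f \<Longrightarrow> Ck k g \<Longrightarrow> Ck k (\<lambda>x. pr (f x) (g x))"
proof (induction k arbitrary: f g)
  case 0
  then show ?case using bounded_bilinear.continuous_on[OF B] by auto
next
  case (Suc k)
  obtain f' where f'[rule_format]: "\<forall>x. (f has_derivative f' x) (at x)" "\<forall>v. Ck k (\<lambda>x. f' x v)"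
    using Suc.prems(1) by (rule Ck_SucE)
  obtain g' where g'[rule_format]: "\<forall>x. (g has_derivative g' x) (at x)" "\<forall>v. Ck k (\<lambda>x. g' x v)"
    using Suc.prems(2) by (rule Ck_SucE)
  show ?case
  proof (rule Ck_SucI)
    show "((\<lambda>x. pr (f x) (g x)) has_derivative
        (\<lambda>v. pr (f x) (g' x v) + pr (f' x v) (g x))) (at x)" for x
      by (rule bounded_bilinear.FDERIV[OF B f'(1) g'(1)])
    show "Ck k (\<lambda>x. pr (f x) (g' x v) + pr (f' x v) (g x))" for v
      by (rule Ck_add[OF Suc.IH[OF Ck_Suc_imp[OF Suc.prems(1)] g'(2)] Suc.IH[OF f'(2) Ck_Suc_imp[OF Suc.prems(2)]]])
  qed
qed

lemmas Ck_mult = Ck_bilinear[OF bounded_bilinear_mult]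
lemmas Ck_scaleR = Ck_bilinear[OF bounded_bilinear_scaleR]
lemmas Ck_inner = Ck_bilinear[OF bounded_bilinear_inner]

lemma Ck_diff: "Ck k f \<Longrightarrow> Ck k g \<Longrightarrow> Ck k (\<lambda>x. f x - g x)"
  using Ck_add[OF _ Ck_bounded_linear[OF bounded_linear_minus[OF bounded_linear_ident]], of k f g]
  by simp

lemma Ck_prod:
  fixes f :: "'i \<Rightarrow> 'a::euclidean_space \<Rightarrow> 'b::real_normed_field"
  shows "(\<And>i. i \<in> I \<Longrightarrow> Ck k (f i)) \<Longrightarrow> Ck k (\<lambda>x. \<Prod>i\<in>I. f i x)"
  by (induction I rule: infinite_finite_induct) (auto intro: Ck_const Ck_mult)

lemma linear_basis_expansion:
  fixes L :: "'a::euclidean_space \<Rightarrow> 'b::real_vector"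
  assumes "linear L"
  shows "L v = (\<Sum>b\<in>Basis. (v \<bullet> b) *\<^sub>R L b)"
proof -
  have "L (\<Sum>b\<in>Basis. (v \<bullet> b) *\<^sub>R b) = (\<Sum>b\<in>Basis. (v \<bullet> b) *\<^sub>R L b)"
    using assms by (simp only: linear_sum linear_scale)
  then show ?thesis by (simp only: euclidean_representation)
qed

text \<open>
  The chain rule gives \<open>D(f \<circ> g)(x) v = Df(g x)(Dg(x) v)\<close>, where the direction also depends on \<open>x\<close>.
  Expanding that direction in the basis leaves derivatives of \<open>f\<close> in fixed directions, to which
  the induction hypothesis applies.
\<close>
lemma Ck_compose:
  "Ck k f \<Longrightarrow> Ck k g \<Longrightarrow> Ck k (\<lambda>x. f (g x))"
proof (induction k arbitrary: f)
  case 0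
  then show ?case by (auto intro: continuous_on_compose2)
next
  case (Suc k)
  obtain f' where f'[rule_format]: "\<forall>x. (f has_derivative f' x) (at x)" "\<forall>v. Ck k (\<lambda>x. f' x v)"
    using Suc.prems(1) by (rule Ck_SucE)
  obtain g' where g'[rule_format]: "\<forall>x. (g has_derivative g' x) (at x)" "\<forall>v. Ck k (\<lambda>x. g' x v)"
    using Suc.prems(2) by (rule Ck_SucE)
  show ?case
  proof (rule Ck_SucI)
    show "((\<lambda>x. f (g x)) has_derivative (\<lambda>v. f' (g x) (g' x v))) (at x)" for x
      using diff_chain_at[OF g'(1) f'(1)] by (simp add: o_def)
    fix v
    have "Ck k (\<lambda>x. \<Sum>b\<in>Basis. (g' x v \<bullet> b) *\<^sub>R f' (g x) b)"
      by (intro Ck_sum Ck_scaleR Ck_inner g' Ck_const Suc.IH[OF f'(2) Ck_Suc_imp[OF Suc.prems(2)]])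
    moreover have "(\<Sum>b\<in>Basis. (g' x v \<bullet> b) *\<^sub>R f' (g x) b) = f' (g x) (g' x v)" for x
      by (rule linear_basis_expansion[OF has_derivative_linear[OF f'(1)], symmetric])
    ultimately show "Ck k (\<lambda>x. f' (g x) (g' x v))" by simp
  qed
qed

lemma Ck_inverse:
  fixes f :: "'a::euclidean_space \<Rightarrow> real"
  assumes nz: "\<And>x. f x \<noteq> 0"
  shows "Ck k f \<Longrightarrow> Ck k (\<lambda>x. inverse (f x))"
proof (induction k)
  case 0
  then show ?case using nz by (auto intro: continuous_intros)
next
  case (Suc k)
  obtain f' where f'[rule_format]: "\<forall>x. (f has_derivative f' x) (at x)" "\<forall>v. Ck k (\<lambda>x. f' x v)"
    using Suc.prems(1) by (rule Ck_SucE)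
  show ?case
  proof (rule Ck_SucI)
    show "((\<lambda>x. inverse (f x)) has_derivative
       (\<lambda>v. 0 - (inverse (f x) * f' x v * inverse (f x)))) (at x)" for x
      using Deriv.has_derivative_inverse[OF nz f'(1)] by simp
    show "Ck k (\<lambda>x. 0 - (inverse (f x) * f' x v * inverse (f x)))" for v
      by (intro Ck_diff Ck_mult Ck_const Suc.IH[OF Ck_Suc_imp[OF Suc.prems]] f')
  qed
qed

lemma Ck_det:
  fixes A :: "'a::euclidean_space \<Rightarrow> real ^ 'n ^ 'n"
  assumes "\<And>i j. Ck k (\<lambda>x. A x $ i $ j)"
  shows "Ck k (\<lambda>x. det (A x))"
  unfolding det_def by (intro Ck_sum Ck_mult Ck_prod Ck_const assms)

lemma Ck_vec:
  fixes f :: "'a::euclidean_space \<Rightarrow> real ^ 'n"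
  assumes "\<And>i. Ck k (\<lambda>x. f x $ i)"
  shows "Ck k f"
proof -
  have "Ck k (\<lambda>x. \<Sum>i\<in>UNIV. (f x $ i) *\<^sub>R axis i (1::real))"
    by (intro Ck_sum Ck_scaleR assms Ck_const)
  moreover have "(\<Sum>i\<in>UNIV. (f x $ i) *\<^sub>R axis i 1) = f x" for x
    using basis_expansion[of "f x"] by (simp add: scalar_mult_eq_scaleR)
  ultimately show ?thesis by simp
qed

lemma Ck_if_const: "(P \<Longrightarrow> Ck k f) \<Longrightarrow> (\<not> P \<Longrightarrow> Ck k g) \<Longrightarrow> Ck k (\<lambda>x. if P then f x else g x)"
  by (cases P) auto

text \<open>
  Cramer's rule writes the solution of a linear system as a rational function of its entries, so
  the solution inherits their smoothness.
\<close>
lemma Ck_linear_solve: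
  fixes A :: "'a::euclidean_space \<Rightarrow> real ^ 'n ^ 'n"
  assumes A: "\<And>i j. Ck k (\<lambda>x. A x $ i $ j)" and nz: "\<And>x. det (A x) \<noteq> 0"
    and w: "\<And>x. A x *v w x = v"
  shows "Ck k w"
proof (rule Ck_vec)
  fix i
  have "Ck k (\<lambda>x. det (\<chi> p q. if q = i then v $ p else A x $ p $ q) * inverse (det (A x)))"
    by (intro Ck_mult Ck_inverse Ck_det nz A, simp only: vec_lambda_beta)
       (intro Ck_if_const Ck_const A)
  moreover have "w x $ i = det (\<chi> p q. if q = i then v $ p else A x $ p $ q) * inverse (det (A x))" for x
  proof -
    have "w x = (\<chi> k. det (\<chi> p q. if q = k then v $ p else A x $ p $ q) / det (A x))"
      using w[of x] unfolding cramer[OF nz] .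
    then have "w x $ i = (\<chi> k. det (\<chi> p q. if q = k then v $ p else A x $ p $ q) / det (A x)) $ i"
      by (rule arg_cong)
    then show ?thesis by (simp only: vec_lambda_beta divide_inverse)
  qed
  ultimately show "Ck k (\<lambda>x. w x $ i)" by simp
qed

text \<open>
  Differentiation under the integral sign. Smoothness of the integrand in both variables jointly is
  what makes the induction work: the derivative in the direction \<open>(v, 0)\<close> is again such an
  integrand.
\<close>
lemma Ck_integral:
  fixes h :: "'a::euclidean_space \<times> real \<Rightarrow> 'b::euclidean_space"
  shows "Ck k h \<Longrightarrow> Ck k (\<lambda>x. integral {a..b} (\<lambda>t. h (x, t)))"
proof (induction k arbitrary: h)
  case 0
  then show ?case
    using integral_continuous_on_param[of UNIV a b "\<lambda>x t. h (x, t)"]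
    by (auto simp: split_beta intro: continuous_on_subset)
next
  case (Suc k)
  obtain h' where h'[rule_format]: "\<forall>p. (h has_derivative h' p) (at p)" "\<forall>v. Ck k (\<lambda>p. h' p v)"
    using Suc.prems(1) by (rule Ck_SucE)
  define D where "D = (\<lambda>x t. Blinfun (\<lambda>v. h' (x, t) (v, 0)))"
  have deriv: "((\<lambda>x. h (x, t)) has_derivative (\<lambda>v. h' (x, t) (v, 0))) (at x)" for x t
    using diff_chain_at[OF has_derivative_Pair[OF has_derivative_ident has_derivative_const] h'(1)]
    by (simp add: o_def)
  then have D: "blinfun_apply (D x t) = (\<lambda>v. h' (x, t) (v, 0))" for x t
    unfolding D_def by (intro bounded_linear_Blinfun_apply has_derivative_bounded_linear)
  have "continuous_on S (\<lambda>p. h' (fst p, snd p) (v, 0))" for S v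
    using Ck_continuous[OF h'(2)] by simp
  then have cont: "continuous_on (UNIV \<times> cbox a b) (\<lambda>(x, t). D x t)"
    by (intro continuous_on_blinfun_componentwise) (simp add: split_beta D)
  have D_int: "D x integrable_on cbox a b" for x
  proof (rule integrable_continuous)
    have "continuous_on (cbox a b) (\<lambda>t. (\<lambda>(x, t). D x t) (x, t))"
      by (rule continuous_on_compose2[OF cont]) (auto intro: continuous_intros)
    then show "continuous_on (cbox a b) (D x)" by simp
  qed
  have h_int: "(\<lambda>t. h (x, t)) integrable_on cbox a b" for x
    by (intro integrable_continuous continuous_on_compose2[OF Ck_continuous[OF Suc.prems, of UNIV]])
       (auto intro: continuous_intros)
  show ?case
  proof (rule Ck_SucI)
    fix x
    have "blinfun_apply (integral {a..b} (D x)) = (\<lambda>v. integral {a..b} (\<lambda>t. h' (x, t) (v, 0)))"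
      using blinfun_apply_integral[OF D_int[of x]] by (auto simp: D)
    then show "((\<lambda>x. integral {a..b} (\<lambda>t. h (x, t))) has_derivative
        (\<lambda>v. integral {a..b} (\<lambda>t. h' (x, t) (v, 0)))) (at x)"
      using leibniz_rule[of UNIV a b "\<lambda>x t. h (x, t)" D x] deriv h_int cont by (simp add: D)
    show "Ck k (\<lambda>x. integral {a..b} (\<lambda>t. h' (x, t) (v, 0)))" for v
      by (rule Suc.IH[OF h'(2)])
  qed
qed

section \<open>Localising a perturbation\<close>

lemma has_derivative_pos_part_power:
  "((\<lambda>s. max 0 s ^ Suc (Suc n)) has_derivative (\<lambda>v. real (n + 2) * max 0 s ^ Suc n * v)) (at (s::real))"
proof -
  consider "s < 0" | "s = 0" | "s > 0" by linarith
  then show ?thesis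
  proof cases
    case 1
    have "((\<lambda>s::real. 0) has_derivative (\<lambda>v::real. real (n + 2) * max 0 s ^ Suc n * v)) (at s)"
      using 1 by simp
    then show ?thesis
      by (rule has_derivative_transform_within_open[where s = "{..<0}"]) (use 1 in auto)
  next
    case 3
    have "((\<lambda>s::real. s ^ Suc (Suc n)) has_derivative (\<lambda>v::real. real (n + 2) * max 0 s ^ Suc n * v)) (at s)"
      using 3 DERIV_pow[of "Suc (Suc n)" s] by (simp add: has_field_derivative_def add.commute)
    then show ?thesis
      by (rule has_derivative_transform_within_open[where s = "{0<..}"]) (use 3 in auto)
  next
    case 2
    have "((\<lambda>h::real. max 0 h ^ Suc (Suc n) / h) \<longlongrightarrow> 0) (at 0)"
    proof (rule Lim_null_comparison)
      have "norm (max 0 h ^ Suc (Suc n) / h) \<le> \<bar>h\<bar> ^ Suc n" for h :: real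
      proof (cases "h > 0")
        case False
        then have "max 0 h ^ Suc (Suc n) / h = 0" by simp
        then show ?thesis by (simp only: norm_zero zero_le_power abs_ge_zero)
      qed simp
      then show "\<forall>\<^sub>F h in at 0. norm (max 0 h ^ Suc (Suc n) / h) \<le> \<bar>h::real\<bar> ^ Suc n"
        by simp
      show "((\<lambda>h::real. \<bar>h\<bar> ^ Suc n) \<longlongrightarrow> 0) (at 0)"
        by (auto intro!: tendsto_eq_intros)
    qed
    then have "DERIV (\<lambda>s. max 0 s ^ Suc (Suc n)) 0 :> (0::real)"
      by (simp add: DERIV_def)
    moreover have "(*) 0 = (\<lambda>v. real (n + 2) * max 0 s ^ Suc n * v)"
      using 2 by auto
    ultimately show ?thesis
      using 2 by (simp only: has_field_derivative_def)
  qed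
qed

lemma Ck_pos_part_power: "Ck n (\<lambda>s::real. max 0 s ^ Suc n)"
proof (induction n)
  case 0
  then show ?case by (auto intro: continuous_intros)
next
  case (Suc n)
  show ?case
    by (rule Ck_SucI[OF has_derivative_pos_part_power]) (intro Ck_mult Ck_const Suc)
qed

lemma bounded_of_continuous_compact_support:
  fixes f :: "'a::euclidean_space \<Rightarrow> 'b::real_normed_vector"
  assumes "continuous_on UNIV f" and "\<And>x. norm x \<ge> R \<Longrightarrow> f x = 0"
  obtains M where "M > 0" "\<forall>x. norm (f x) \<le> M"
proof -
  have "bounded (f ` cball 0 R)"
    using assms(1) by (intro compact_imp_bounded compact_continuous_image)
      (auto intro: continuous_on_subset)
  then obtain M where M: "M > 0" "\<And>y. y \<in> f ` cball 0 R \<Longrightarrow> norm y \<le> M"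
    by (auto simp: bounded_pos)
  have "norm (f x) \<le> M" for x
    using M assms(2)[of x] by (cases "norm x \<le> R") auto
  with M(1) show thesis by (intro that) auto
qed

lemma linear_norm_le_sum_Basis:
  fixes L :: "'a::euclidean_space \<Rightarrow> 'b::real_normed_vector"
  assumes "linear L"
  shows "norm (L v) \<le> (\<Sum>b\<in>Basis. norm (L b)) * norm v"
proof -
  have "norm (L v) \<le> (\<Sum>b\<in>Basis. norm ((v \<bullet> b) *\<^sub>R L b))"
    unfolding linear_basis_expansion[OF assms, of v] by (rule norm_sum)
  also have "\<dots> \<le> (\<Sum>b\<in>Basis. norm (L b) * norm v)"
  proof (rule sum_mono)
    fix b :: 'a assume "b \<in> Basis"
    then have "\<bar>v \<bullet> b\<bar> * norm (L b) \<le> norm v * norm (L b)"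
      by (intro mult_right_mono Basis_le_norm) auto
    then show "norm ((v \<bullet> b) *\<^sub>R L b) \<le> norm (L b) * norm v"
      by (simp add: mult.commute)
  qed
  finally show ?thesis by (simp add: sum_distrib_right)
qed

text \<open>
  Since \<open>p s = (max 0 s) ^ (k + 2)\<close> vanishes for \<open>s \<le> 0\<close> and is at least \<open>1\<close> for \<open>s \<ge> 1\<close>, the function
  \<open>p (1 - p s)\<close> equals \<open>1\<close> for \<open>s \<le> 0\<close> and \<open>0\<close> for \<open>s \<ge> 1\<close>. Evaluated at \<open>\<bar>x\<bar>\<^sup>2 - 1\<close> it is a cutoff of
  finite smoothness; multiplying \<open>x\<close> by it gives a map with compact support, so the map and its
  derivative are bounded.
\<close>
lemma Ck_localisation_exists:
  obtains \<rho> :: "'a::euclidean_space \<Rightarrow> 'a" and \<rho>' :: "'a \<Rightarrow> 'a \<Rightarrow> 'a" and M L :: real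
  where "Ck (Suc k) \<rho>" "\<forall>x. norm x < 1 \<longrightarrow> \<rho> x = x"
    "M > 0" "\<forall>x. norm (\<rho> x) \<le> M"
    "\<forall>x. (\<rho> has_derivative \<rho>' x) (at x)"
    "L > 0" "\<forall>x v. norm (\<rho>' x v) \<le> L * norm v"
proof -
  define p where "p = (\<lambda>s::real. max 0 s ^ Suc (Suc k))"
  define \<eta> where "\<eta> = (\<lambda>x::'a. p (1 - p (x \<bullet> x - 1)))"
  define \<rho> where "\<rho> = (\<lambda>x::'a. \<eta> x *\<^sub>R x)"
  have p: "Ck (Suc k) p"
    unfolding p_def by (rule Ck_pos_part_power)
  have "Ck (Suc k) \<eta>"
    unfolding \<eta>_def by (intro Ck_compose[OF p] Ck_diff Ck_inner Ck_id Ck_const)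
  then have \<rho>: "Ck (Suc k) \<rho>"
    unfolding \<rho>_def by (intro Ck_scaleR Ck_id)
  have id: "\<rho> x = x" if "norm x < 1" for x
  proof -
    have "x \<bullet> x < 1"
      using that by (simp add: dot_square_norm power_less_one_iff)
    then show ?thesis by (simp add: \<rho>_def \<eta>_def p_def)
  qed
  \<comment> \<open>the cutoff vanishes from radius \<open>\<surd>2\<close> on; a radius below \<open>2\<close> leaves room for the derivative to vanish at radius \<open>2\<close>\<close>
  have zero: "\<rho> x = 0" if "norm x > 3/2" for x
  proof -
    have "x \<bullet> x \<ge> (3/2)^2"
      using that unfolding dot_square_norm by (intro power_mono) auto
    then have "x \<bullet> x - 1 \<ge> 1" by (simp add: power2_eq_square)
    then have "p (x \<bullet> x - 1) \<ge> 1"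
      unfolding p_def by (intro one_le_power) simp
    then show ?thesis by (simp add: \<rho>_def \<eta>_def p_def)
  qed
  obtain \<rho>' where \<rho>'[rule_format]: "\<forall>x. (\<rho> has_derivative \<rho>' x) (at x)" "\<forall>v. Ck k (\<lambda>x. \<rho>' x v)"
    using \<rho> by (rule Ck_SucE)
  have "\<rho> x = 0" if "norm x \<ge> 2" for x
    using that by (intro zero) simp
  then obtain M where M[rule_format]: "M > 0" "\<forall>x. norm (\<rho> x) \<le> M"
    by (rule bounded_of_continuous_compact_support[OF Ck_continuous[OF \<rho>]])
  have zero': "\<rho>' x = (\<lambda>v. 0)" if "norm x \<ge> 2" for x
  proof -
    have "open {x::'a. norm x > 3/2}"
      by (intro open_Collect_less continuous_intros)
    moreover have "x \<in> {x. norm x > 3/2}" using that by simp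
    ultimately have "((\<lambda>x. 0) has_derivative \<rho>' x) (at x)"
      by (rule has_derivative_transform_within_open[OF \<rho>'(1)]) (simp add: zero)
    then show ?thesis
      by (rule has_derivative_unique[OF _ has_derivative_const])
  qed
  define S where "S = (\<lambda>x. \<Sum>b\<in>Basis. norm (\<rho>' x b))"
  have "continuous_on UNIV S"
    unfolding S_def by (intro continuous_intros Ck_continuous[OF \<rho>'(2)])
  moreover have "S x = 0" if "norm x \<ge> 2" for x
    using zero'[OF that] by (simp add: S_def)
  ultimately obtain L where L[rule_format]: "L > 0" "\<forall>x. norm (S x) \<le> L"
    by (rule bounded_of_continuous_compact_support)
  have "norm (\<rho>' x v) \<le> L * norm v" for x v
  proof -
    have "norm (\<rho>' x v) \<le> S x * norm v"
      unfolding S_def by (rule linear_norm_le_sum_Basis[OF has_derivative_linear[OF \<rho>'(1)]])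
    also have "\<dots> \<le> L * norm v"
      using L(2)[of x] by (intro mult_right_mono) auto
    finally show ?thesis .
  qed
  with \<rho> id M \<rho>'(1) L(1) show thesis by (intro that[of \<rho> M \<rho>' L]) auto
qed

text \<open>
  With \<open>\<rho>\<close> a bounded map that is the identity near \<open>0\<close>, take \<open>g x = r (\<delta> \<rho> (x / \<delta>))\<close>. The rescaled map
  takes values in a ball of radius proportional to \<open>\<delta>\<close>, where the derivative of \<open>r\<close> is as small as
  desired, while the bound on its own derivative does not depend on \<open>\<delta>\<close>.
\<close>
lemma Ck_flatten:
  fixes r :: "'a::euclidean_space \<Rightarrow> 'b::euclidean_space"
  assumes r: "Ck (Suc k) r" and r0: "r 0 = 0" and dr0: "(r has_derivative (\<lambda>v. 0)) (at 0)"
    and e: "e > 0"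
  obtains g g' \<delta> where "Ck (Suc k) g" "\<And>x. (g has_derivative g' x) (at x)"
    "\<And>x v. norm (g' x v) \<le> e * norm v" "\<delta> > 0" "\<And>x. norm x < \<delta> \<Longrightarrow> g x = r x"
proof -
  obtain r' where r'[rule_format]: "\<forall>x. (r has_derivative r' x) (at x)" "\<forall>v. Ck k (\<lambda>x. r' x v)"
    using r by (rule Ck_SucE)
  obtain \<rho> :: "'a \<Rightarrow> 'a" and \<rho>' M L where
    \<rho>[rule_format]: "Ck (Suc k) \<rho>" "\<forall>x. norm x < 1 \<longrightarrow> \<rho> x = x"
    and M[rule_format]: "M > 0" "\<forall>x. norm (\<rho> x) \<le> M"
    and \<rho>'[rule_format]: "\<forall>x. (\<rho> has_derivative \<rho>' x) (at x)"
    and L[rule_format]: "L > 0" "\<forall>x v. norm (\<rho>' x v) \<le> L * norm v"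
    by (rule Ck_localisation_exists[of k])
  define S where "S = (\<lambda>x. \<Sum>b\<in>Basis. norm (r' x b))"
  have "continuous_on UNIV S"
    unfolding S_def by (intro continuous_intros Ck_continuous[OF r'(2)])
  then have "isCont S 0" by (simp add: continuous_on_eq_continuous_at)
  moreover have "S 0 = 0"
    using has_derivative_unique[OF r'(1) dr0] by (simp add: S_def)
  moreover have "0 < e / L" using e L(1) by simp
  ultimately obtain d where d: "d > 0" "\<forall>x. dist x 0 < d \<longrightarrow> dist (S x) (S 0) < e / L"
    unfolding continuous_at_eps_delta by blast
  have small: "S x < e / L" if "norm x < d" for x
    using d(2)[rule_format, of x] that \<open>S 0 = 0\<close> by (simp add: dist_norm)
  \<comment> \<open>then \<open>\<delta> M < d\<close>, so the rescaled map stays in the ball of radius \<open>d\<close>\<close>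
  define \<delta> where "\<delta> = d / (2 * M)"
  have \<delta>: "\<delta> > 0" using d M by (simp add: \<delta>_def)
  define g where "g = (\<lambda>x. r (\<delta> *\<^sub>R \<rho> (x /\<^sub>R \<delta>)))"
  define g' where "g' = (\<lambda>x v. r' (\<delta> *\<^sub>R \<rho> (x /\<^sub>R \<delta>)) (\<rho>' (x /\<^sub>R \<delta>) v))"
  have "Ck (Suc k) g"
    unfolding g_def by (intro Ck_compose[OF r] Ck_scaleR Ck_const Ck_compose[OF \<rho>(1)] Ck_id)
  moreover have "(g has_derivative g' x) (at x)" for x
  proof -
    have 1: "((\<lambda>x. x /\<^sub>R \<delta>) has_derivative (\<lambda>v. v /\<^sub>R \<delta>)) (at x)"
      by (auto intro!: derivative_eq_intros)
    have 2: "((\<lambda>x. \<delta> *\<^sub>R \<rho> (x /\<^sub>R \<delta>)) has_derivative (\<lambda>v. \<delta> *\<^sub>R \<rho>' (x /\<^sub>R \<delta>) (v /\<^sub>R \<delta>))) (at x)"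
      using diff_chain_at[OF 1 \<rho>'] by (intro has_derivative_scaleR_right) (simp add: o_def)
    \<comment> \<open>the two scalings cancel in the derivative, so its bound is independent of \<open>\<delta>\<close>\<close>
    have "\<delta> *\<^sub>R \<rho>' (x /\<^sub>R \<delta>) (v /\<^sub>R \<delta>) = \<rho>' (x /\<^sub>R \<delta>) v" for v
      using linear_scale[OF has_derivative_linear[OF \<rho>'], of "x /\<^sub>R \<delta>" "inverse \<delta>" v] \<delta> by simp
    then show ?thesis
      using diff_chain_at[OF 2 r'(1)] by (simp add: g_def g'_def o_def)
  qed
  moreover have "norm (g' x v) \<le> e * norm v" for x v
  proof -
    let ?y = "\<delta> *\<^sub>R \<rho> (x /\<^sub>R \<delta>)" and ?w = "\<rho>' (x /\<^sub>R \<delta>) v"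
    have "norm ?y \<le> \<delta> * M" using M(2) \<delta> by simp
    also have "\<dots> < d" using d M by (simp add: \<delta>_def)
    finally have S: "S ?y < e / L" by (rule small)
    have "norm (g' x v) \<le> S ?y * norm ?w"
      unfolding S_def g'_def by (rule linear_norm_le_sum_Basis[OF has_derivative_linear[OF r'(1)]])
    also have "\<dots> \<le> (e / L) * (L * norm v)"
      using S L e by (intro mult_mono) auto
    finally show ?thesis using L by simp
  qed
  moreover have "g x = r x" if "norm x < \<delta>" for x
    using \<rho>(2)[of "x /\<^sub>R \<delta>"] \<delta> that by (simp add: g_def field_simps)
  ultimately show thesis using \<delta> that by blast
qed

section \<open>Inverting a perturbation of the identity\<close>

text \<open>
  A global inverse function theorem. As \<open>g\<close> is a contraction, \<open>x + g x = y\<close> has a unique solution by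
  Banach's fixed point theorem, and the solution is a Lipschitz function of \<open>y\<close>. Its derivative
  solves a linear system with coefficients taken at \<open>\<psi> y\<close>; so if \<open>\<psi>\<close> is of class \<open>C\<^sup>j\<close>, then
  so is its derivative, and \<open>\<psi>\<close> gains orders of smoothness one at a time.
\<close>
lemma Ck_perturbed_identity_inverse:
  fixes g :: "real ^ 'n \<Rightarrow> real ^ 'n"
  assumes g: "Ck (Suc k) g" and deriv_g: "\<And>x. (g has_derivative g' x) (at x)"
    and bound: "\<And>x v. norm (g' x v) \<le> 1/2 * norm v"
  obtains \<psi> where "Ck (Suc k) \<psi>" "\<And>y. \<psi> y + g (\<psi> y) = y" "\<And>x. \<psi> (x + g x) = x"
proof -
  have lip: "norm (g x - g y) \<le> 1/2 * norm (x - y)" for x y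
    by (rule differentiable_bound[OF convex_UNIV deriv_g onorm_le[OF bound]]) auto
  have expand: "norm (x - z) \<le> 2 * norm ((x + g x) - (z + g z))" for x z
  proof -
    have "norm (x - z) = norm (((x + g x) - (z + g z)) - (g x - g z))"
      by (simp add: algebra_simps)
    also have "\<dots> \<le> norm ((x + g x) - (z + g z)) + norm (g x - g z)"
      by (rule norm_triangle_ineq4)
    finally show ?thesis using lip[of x z] by linarith
  qed
  have "\<exists>x. x + g x = y" for y
  proof -
    have "\<exists>!x. y - g x = x"
      by (rule banach_fix_type[where c = "1/2"]) (use lip in \<open>auto simp: dist_norm norm_minus_commute\<close>)
    then show ?thesis by (metis diff_add_cancel)
  qed
  then obtain \<psi> where right: "\<And>y. \<psi> y + g (\<psi> y) = y" by metis
  have left: "\<psi> (x + g x) = x" for x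
    using expand[of "\<psi> (x + g x)" x] right[of "x + g x"] by simp
  have lip_\<psi>: "dist (\<psi> y) (\<psi> z) \<le> 2 * dist y z" for y z
    using expand[of "\<psi> y" "\<psi> z"] by (simp add: right dist_norm)
  have cont: "continuous_on UNIV \<psi>"
    unfolding continuous_on_iff
  proof (intro ballI allI impI)
    fix y e assume "e > (0::real)"
    then show "\<exists>d>0. \<forall>z\<in>UNIV. dist z y < d \<longrightarrow> dist (\<psi> z) (\<psi> y) < e"
      using lip_\<psi>[THEN le_less_trans, of _ _ e] by (intro exI[of _ "e/2"]) auto
  qed
  define \<phi>' where "\<phi>' = (\<lambda>x v. v + g' x v)"
  have deriv_\<phi>: "((\<lambda>x. x + g x) has_derivative \<phi>' x) (at x)" for x
    unfolding \<phi>'_def by (intro has_derivative_add has_derivative_ident deriv_g)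
  have lin: "linear (\<phi>' x)" for x
    by (rule has_derivative_linear[OF deriv_\<phi>])
  have inj: "inj (\<phi>' x)" for x
    unfolding linear_injective_0[OF lin]
  proof (intro allI impI)
    fix v assume "\<phi>' x v = 0"
    then have "norm v = norm (g' x v)"
      by (metis \<phi>'_def add_eq_0_iff norm_minus_cancel)
    then show "v = 0" using bound[of x v] by simp
  qed
  then obtain I where I: "\<And>x. linear (I x)" "\<And>x v. I x (\<phi>' x v) = v" "\<And>x v. \<phi>' x (I x v) = v"
    using linear_injective_isomorphism[OF lin] by metis
  have deriv_\<psi>: "(\<psi> has_derivative I (\<psi> y)) (at y)" for y
  proof (rule has_derivative_inverse_basic[OF deriv_\<phi>, where T = UNIV])
    show "bounded_linear (I (\<psi> y))"
      using I(1) by (simp add: linear_conv_bounded_linear)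
    show "I (\<psi> y) \<circ> \<phi>' (\<psi> y) = id"
      by (auto simp: I)
    show "continuous (at y) \<psi>"
      using cont by (simp add: continuous_on_eq_continuous_at)
  qed (auto simp: right)
  have entry: "Ck k (\<lambda>x. matrix (\<phi>' x) $ i $ j)" for i j
  proof -
    obtain g'' where g''[rule_format]: "\<forall>x. (g has_derivative g'' x) (at x)" "\<forall>v. Ck k (\<lambda>x. g'' x v)"
      using g by (rule Ck_SucE)
    have "g'' = g'"
      using has_derivative_unique[OF g''(1) deriv_g] by blast
    with g'' have "Ck k (\<lambda>x. (axis j 1 + g' x (axis j 1)) $ i)"
      by (intro Ck_bounded_linear[OF bounded_linear_vec_nth] Ck_add Ck_const) auto
    then show ?thesis by (simp add: matrix_def \<phi>'_def)
  qed
  have nz: "det (matrix (\<phi>' x)) \<noteq> 0" for x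
    using det_nz_iff_inj[OF lin[of x]] inj by blast
  have "j \<le> Suc k \<Longrightarrow> Ck j \<psi>" for j
  proof (induction j)
    case 0
    then show ?case using cont by simp
  next
    case (Suc j)
    show ?case
    proof (rule Ck_SucI[OF deriv_\<psi>])
      fix v
      show "Ck j (\<lambda>y. I (\<psi> y) v)"
      proof (rule Ck_linear_solve)
        show "Ck j (\<lambda>y. matrix (\<phi>' (\<psi> y)) $ p $ q)" for p q
          using Suc by (intro Ck_compose[OF Ck_mono[OF entry]]) auto
        show "det (matrix (\<phi>' (\<psi> y))) \<noteq> 0" for y
          by (rule nz)
        show "matrix (\<phi>' (\<psi> y)) *v I (\<psi> y) v = v" for y
          using fun_cong[OF matrix_vector_mul(2)[OF lin[of "\<psi> y"]], of "I (\<psi> y) v"]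
          by (simp only: I)
      qed
    qed
  qed
  from this[OF order_refl] right left show thesis by (rule that)
qed

section \<open>The Hadamard expansion and the division theorem\<close>

text \<open>
  A form of Hadamard's lemma: the fundamental theorem of calculus along
  \<open>t \<mapsto> z - B (J z) + t B (J z)\<close>, whose velocity \<open>B (J z)\<close> is a combination of the vectors
  \<open>B e\<^sub>i\<close> with coefficients \<open>(J z)\<^sub>i\<close>. At \<open>z = 0\<close> the integrand is constant, which gives the last
  conclusion.
\<close>
lemma Ck_hadamard:
  fixes G :: "'a::euclidean_space \<Rightarrow> real"
    and J :: "'a \<Rightarrow> real ^ 'l" and B :: "real ^ 'l \<Rightarrow> 'a"
  assumes G: "Ck (Suc k) G" and J: "linear J" and B: "linear B"
  obtains K where "\<forall>i. Ck k (K i)"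
    "\<forall>z. G z = G (z - B (J z)) + (\<Sum>i\<in>UNIV. J z $ i * K i z)"
    "\<forall>D i. (G has_derivative D) (at 0) \<longrightarrow> K i 0 = D (B (axis i 1))"
proof -
  obtain G' where G'[rule_format]: "\<forall>x. (G has_derivative G' x) (at x)" "\<forall>v. Ck k (\<lambda>x. G' x v)"
    using G by (rule Ck_SucE)
  have lin: "linear (G' x)" for x
    by (rule has_derivative_linear[OF G'(1)])
  have blin: "bounded_linear (\<lambda>z. B (J z))"
    using linear_compose[OF J B] by (simp add: linear_conv_bounded_linear o_def)
  define line where "line = (\<lambda>(z, t::real). z - B (J z) + t *\<^sub>R B (J z))"
  have line: "Ck j line" for j
    unfolding line_def split_beta
    by (intro Ck_add Ck_diff Ck_scaleR Ck_bounded_linear[OF blin]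
          Ck_bounded_linear[OF bounded_linear_fst] Ck_bounded_linear[OF bounded_linear_snd] Ck_id)
  define H where "H = (\<lambda>i p. G' (line p) (B (axis i 1)))"
  have H: "Ck k (H i)" for i
    unfolding H_def by (intro Ck_compose[OF G'(2)] line)
  define K where "K = (\<lambda>i z. integral {0..1} (\<lambda>t. H i (z, t)))"
  have "Ck k (K i)" for i
    unfolding K_def by (rule Ck_integral[OF H])
  moreover have "G z = G (z - B (J z)) + (\<Sum>i\<in>UNIV. J z $ i * K i z)" for z
  proof -
    have int: "(\<lambda>t. H i (z, t)) integrable_on {0..1}" for i
      by (intro integrable_continuous_real continuous_on_compose2[OF Ck_continuous[OF H, of UNIV]])
         (auto intro: continuous_intros)
    have path: "((\<lambda>t. G (line (z, t))) has_vector_derivative (\<Sum>i\<in>UNIV. J z $ i * H i (z, t)))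
        (at t within {0..1})" for t
    proof -
      have "((\<lambda>t. line (z, t)) has_derivative (\<lambda>s. s *\<^sub>R B (J z))) (at t)"
        unfolding line_def by (auto intro!: derivative_eq_intros)
      then have "((\<lambda>t. G (line (z, t))) has_derivative (\<lambda>s. G' (line (z, t)) (s *\<^sub>R B (J z)))) (at t)"
        using diff_chain_at[OF _ G'(1), unfolded o_def] by blast
      moreover have "G' (line (z, t)) (B (J z)) = (\<Sum>i\<in>UNIV. J z $ i * H i (z, t))"
      proof -
        have "G' (line (z, t)) (B (\<Sum>i\<in>UNIV. J z $ i *\<^sub>R axis i 1)) = (\<Sum>i\<in>UNIV. J z $ i * H i (z, t))"
          by (simp only: linear_sum[OF B] linear_sum[OF lin]
             linear_scale[OF B] linear_scale[OF lin] H_def real_scaleR_def)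
        moreover have "(\<Sum>i\<in>UNIV. J z $ i *\<^sub>R axis i 1) = J z"
          using basis_expansion[of "J z"] by (simp only: scalar_mult_eq_scaleR)
        ultimately show ?thesis by (simp only:)
      qed
      ultimately show ?thesis
        unfolding has_vector_derivative_def
        by (simp only: linear_scale[OF lin] has_derivative_at_withinI)
    qed
    have "((\<lambda>t. \<Sum>i\<in>UNIV. J z $ i * H i (z, t)) has_integral G (line (z, 1)) - G (line (z, 0))) {0..1}"
      using fundamental_theorem_of_calculus[OF _ path] by simp
    moreover have "((\<lambda>t. \<Sum>i\<in>UNIV. J z $ i * H i (z, t)) has_integral (\<Sum>i\<in>UNIV. J z $ i * K i z)) {0..1}"
      unfolding K_def
      by (intro has_integral_sum has_integral_mult_right integrable_integral int) auto
    ultimately have "G (line (z, 1)) - G (line (z, 0)) = (\<Sum>i\<in>UNIV. J z $ i * K i z)"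
      by (rule has_integral_unique)
    then show ?thesis by (simp add: line_def)
  qed
  moreover have "K i 0 = D (B (axis i 1))" if "(G has_derivative D) (at 0)" for D i
    using has_derivative_unique[OF that G'(1)]
    by (simp add: K_def H_def line_def linear_0[OF J] linear_0[OF B])
  ultimately show thesis by (intro that[of K] allI impI)
qed

theorem lemma4p4:
  fixes k :: nat
    and F :: "real ^ 'm \<Rightarrow> real"
    and c :: "'l::finite \<Rightarrow> real ^ 'm \<Rightarrow> real"
    and N :: "(real ^ 'm) set"
  assumes "k \<ge> 1"
    and "CARD('l) \<le> CARD('m)"
    and "Ck k F"
    and "\<And>i. Ck k (c i)"
    and "F 0 = 0"
    and "\<And>i. c i 0 = 0"
    and "0 \<in> interior N"
    and "\<And>x. x \<in> N \<Longrightarrow> (\<And>i. c i x = 0) \<Longrightarrow> F x = 0"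
    and "rank (jacobian (\<lambda>x. \<chi> i. c i x) (at 0)) = CARD('l)"
  shows "\<exists>Nstar Fs. Nstar \<subseteq> N \<and> 0 \<in> interior Nstar
           \<and> (\<forall>i::'l. Ck (k - 1) (Fs i :: real ^ 'm \<Rightarrow> real))
           \<and> (\<forall>x\<in>Nstar. F x = (\<Sum>i\<in>UNIV. c i x * Fs i x))
           \<and> (GDERIV F 0 :> 0 \<longrightarrow> (\<forall>i. Fs i 0 = 0))"
proof -
  obtain n where k: "k = Suc n"
    using \<open>k \<ge> 1\<close> by (cases k) auto
  note F = \<open>Ck k F\<close>[unfolded k]
  define C where "C = (\<lambda>x. \<chi> i. c i x)"
  have C: "Ck (Suc n) C"
    using assms(4) by (intro Ck_vec) (simp add: C_def k)
  have C0: "C 0 = 0"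
    using assms(6) by (simp add: C_def vec_eq_iff)
  define J where "J = (*v) (jacobian C (at 0))"
  have J: "linear J" by (simp add: J_def)
  have deriv_C: "(C has_derivative J) (at 0)"
    using C unfolding J_def by (simp flip: jacobian_works)
  have "surj J"
    using assms(9) unfolding J_def C_def by (simp add: full_rank_surjective)
  then obtain B where B: "linear B" "\<And>y. J (B y) = y"
    using linear_surjective_right_inverse[OF J] by (metis o_apply id_apply)
  have bJ: "bounded_linear J" and bB: "bounded_linear B"
    using J B by (simp_all add: linear_conv_bounded_linear)

  define r where "r = (\<lambda>x. B (C x) - B (J x))"
  have r: "Ck (Suc n) r"
    unfolding r_def by (intro Ck_diff Ck_bounded_linear[OF bB] Ck_bounded_linear[OF bJ] C Ck_id)
  have r0: "r 0 = 0"
    by (simp add: r_def C0 linear_0[OF J])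
  have "(r has_derivative (\<lambda>v. B (J v) - B (J v))) (at 0)"
    unfolding r_def
    by (intro has_derivative_diff bounded_linear.has_derivative[OF bB] deriv_C
          bounded_linear.has_derivative[OF bJ] has_derivative_ident)
  then have dr0: "(r has_derivative (\<lambda>v. 0)) (at 0)" by simp
  obtain g g' \<delta> where g: "Ck (Suc n) g" "\<And>x. (g has_derivative g' x) (at x)"
      "\<And>x v. norm (g' x v) \<le> 1/2 * norm v"
    and \<delta>: "\<delta> > 0" "\<And>x. norm x < \<delta> \<Longrightarrow> g x = r x"
    using Ck_flatten[OF r r0 dr0, of "1/2"] by (metis zero_less_divide_1_iff zero_less_numeral)
  obtain \<psi> where \<psi>: "Ck (Suc n) \<psi>" "\<And>y. \<psi> y + g (\<psi> y) = y" "\<And>x. \<psi> (x + g x) = x"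
    using Ck_perturbed_identity_inverse[OF g] by blast
  define \<phi> where "\<phi> = (\<lambda>x. x + g x)"
  have \<phi>: "Ck (Suc n) \<phi>"
    unfolding \<phi>_def by (intro Ck_add Ck_id g)
  have \<phi>0: "\<phi> 0 = 0" and \<psi>0: "\<psi> 0 = 0"
    using \<delta> r0 \<psi>(3)[of 0] by (simp_all add: \<phi>_def)
  \<comment> \<open>\<open>J B\<close> is the identity, so the two occurrences of \<open>J x\<close> cancel\<close>
  have straighten: "J (\<phi> x) = C x" if "norm x < \<delta>" for x
    using \<delta>(2)[OF that] by (simp add: \<phi>_def r_def linear_add[OF J] linear_diff[OF J] B)

  define G where "G = (\<lambda>z. F (\<psi> z))"
  have G: "Ck (Suc n) G"
    unfolding G_def by (intro Ck_compose[OF F] \<psi>)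
  obtain K where K[rule_format]: "\<forall>i. Ck n (K i)"
      "\<forall>z. G z = G (z - B (J z)) + (\<Sum>i\<in>UNIV. J z $ i * K i z)"
    and K0[rule_format]: "\<forall>D i. (G has_derivative D) (at 0) \<longrightarrow> K i 0 = D (B (axis i 1))"
    by (rule Ck_hadamard[OF G J B(1)])

  \<comment> \<open>\<open>s\<close> retracts a neighbourhood of \<open>0\<close> onto the common zero set of the \<open>c\<^sub>i\<close>\<close>
  define s where "s = (\<lambda>x. \<psi> (\<phi> x - B (J (\<phi> x))))"
  have "Ck (Suc n) s"
    unfolding s_def
    by (intro Ck_compose[OF \<psi>(1)] Ck_diff Ck_bounded_linear[OF bB] Ck_bounded_linear[OF bJ] \<phi>)
  then have cont_s: "continuous_on UNIV s" by (rule Ck_continuous)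
  have s0: "s 0 = 0"
    by (simp add: s_def \<phi>0 \<psi>0 linear_0[OF J] linear_0[OF B(1)])
  define U where "U = interior N \<inter> ball 0 \<delta>"
  define V where "V = U \<inter> s -` U"
  have "open V"
    using cont_s by (auto simp: V_def U_def intro!: open_Int open_vimage)
  moreover have "0 \<in> V"
    using assms(7) \<delta>(1) s0 by (simp add: V_def U_def)
  ultimately have "0 \<in> interior V"
    by (simp only: interior_open)
  moreover have "V \<subseteq> N"
    using interior_subset by (auto simp: V_def U_def)
  moreover have "Ck (k - 1) (\<lambda>x. K i (\<phi> x))" for i
    using Ck_compose[OF K(1) Ck_Suc_imp[OF \<phi>]] by (simp add: k)
  moreover have "F x = (\<Sum>i\<in>UNIV. c i x * K i (\<phi> x))" if "x \<in> V" for x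
  proof -
    have x: "norm x < \<delta>" and sx: "norm (s x) < \<delta>" "s x \<in> N"
      using that interior_subset by (auto simp: V_def U_def)
    \<comment> \<open>\<open>J (z - B (J z)) = 0\<close>, so \<open>s x\<close> is a common zero of the \<open>c\<^sub>i\<close>\<close>
    have "\<phi> (s x) = \<phi> x - B (J (\<phi> x))"
      unfolding s_def \<phi>_def by (rule \<psi>(2))
    then have "C (s x) = 0"
      using straighten[OF sx(1)] by (simp add: linear_diff[OF J] B)
    then have "F (s x) = 0"
      using sx(2) by (intro assms(8)) (auto simp: C_def vec_eq_iff)
    then have "G (\<phi> x - B (J (\<phi> x))) = 0"
      by (simp add: G_def s_def)
    then show ?thesis
      using K(2)[of "\<phi> x"] straighten[OF x] \<psi>(3)[of x] by (simp add: G_def C_def \<phi>_def)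
  qed
  moreover have "K i (\<phi> 0) = 0" if "GDERIV F 0 :> 0" for i
  proof -
    obtain \<psi>' where \<psi>': "(\<psi> has_derivative \<psi>') (at 0)"
      using Ck_SucE[OF \<psi>(1)] by blast
    have "(F has_derivative (\<lambda>v. 0)) (at (\<psi> 0))"
      using that by (simp add: gderiv_def \<psi>0)
    then have "(G has_derivative (\<lambda>v. 0)) (at 0)"
      using diff_chain_at[OF \<psi>', unfolded o_def] unfolding G_def by blast
    then show ?thesis
      unfolding \<phi>0 by (rule K0)
  qed
  ultimately show ?thesis
    by (intro exI[of _ V] exI[of _ "\<lambda>i x. K i (\<phi> x)"]) auto
qed

end
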